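(* With parameters $k$ and $x$, $$\int_0^\pi \theta \sin \theta\, (1+x^2 \cos^2 \theta)^{1/k}\,d\theta=\pi\; {}_2F_1\left(\tfrac12,-\tfrac1k;\tfrac32;-x^2\right).$$
   Context: Here $k$ and $x$ are parameters for which no explicit range is specified; the identity generalizes Russell's integral, which is the case $k=2$. ${}_2F_1$ is the Gauss hypergeometric function, ${}_2F_1(a,b;c;z)=\sum_{n\ge 0}\frac{(a)_n(b)_n}{(c)_n\,n!}z^n$, with Pochhammer symbol $(a)_n=\Gamma(a+n)/\Gamma(a)$. *)

theory Defs
  imports "HOL-Complex_Analysis.Complex_Analysis"
begin

definition hyp2F1_series :: "complex \<Rightarrow> complex \<Rightarrow> complex \<Rightarrow> complex \<Rightarrow> complex" where
  "hyp2F1_series a b c z =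
     (\<Sum>n. pochhammer a n * pochhammer b n / (pochhammer c n * fact n) * z ^ n)"

definition slit_plane :: "complex set" where
  "slit_plane = - (complex_of_real ` {1..})"

text \<open>
  The Gauss hypergeometric function: the series on the open unit disc, and its analytic
  continuation (principal branch, cut along the real half-line from 1 to infinity) elsewhere.
  The continuation is unique because the slit plane is connected and contains the disc.
  On the cut the value is unspecified.
\<close>
definition hyp2F1 :: "complex \<Rightarrow> complex \<Rightarrow> complex \<Rightarrow> complex \<Rightarrow> complex" where
  "hyp2F1 a b c z =
     (if norm z < 1 then hyp2F1_series a b c z
      else THE w. \<exists>f. f holomorphic_on slit_plane \<and>
                      (\<forall>u\<in>ball 0 1. f u = hyp2F1_series a b c u) \<and> f z = w)"

lemma minus_square_of_real_in_slit_plane: "- (complex_of_real x)\<^sup>2 \<in> slit_plane"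
proof -
  have "- x\<^sup>2 \<noteq> t" if "t \<ge> 1" for t :: real
    using that zero_le_power2[of x] by linarith
  then show ?thesis
    unfolding slit_plane_def
    by (auto simp flip: of_real_power of_real_minus)
qed

end

theory Submission imports Defs begin

text \<open>
  Reflecting \<open>\<theta>\<close> to \<open>\<pi> - \<theta>\<close> and averaging replaces the factor \<open>\<theta>\<close> by \<open>\<pi> / 2\<close>; substituting
  \<open>t = - cos \<theta>\<close> then turns the left-hand side into \<open>\<pi> E(- x\<^sup>2)\<close>, where
  \<open>E z = (1/2) \<integral>\<^sub>-\<^sub>1\<^sup>1 (1 - z t\<^sup>2) powr (1 / k) dt\<close> is an Euler-type integral. On the unit disc, \<open>E\<close> is
  computed by integrating the binomial series termwise, which gives the hypergeometric series.
  Since \<open>E\<close> is holomorphic on the slit plane, it is the analytic continuation of that series.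
\<close>

section \<open>The slit plane\<close>

lemma open_slit_plane: "open slit_plane"
proof -
  have "closed (complex_of_real ` {1..})"
    by (intro closed_injective_linear_image)
      (auto simp: inj_def bounded_linear_of_real bounded_linear.linear)
  then show ?thesis
    unfolding slit_plane_def by auto
qed

text \<open>If the scaled point were some real r >= 1, then z = r / s >= 1 would lie on the cut.
  This yields star-shapedness about 0 and, with s = t^2, keeps 1 - z t^2 off the cut of
  \<open>powr\<close>.\<close>

lemma slit_plane_mult_of_real:
  assumes "z \<in> slit_plane" "0 \<le> s" "s \<le> 1"
  shows "z * of_real s \<in> slit_plane"
proof (rule ccontr)
  assume "z * of_real s \<notin> slit_plane"
  then obtain r where r: "r \<ge> 1" "z * of_real s = of_real r"
    unfolding slit_plane_def by auto
  then have "s > 0"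
    using assms(2) by (cases "s = 0") auto
  then have "z = of_real (r / s)"
    using r by (simp add: field_simps)
  moreover have "r / s \<ge> 1"
    using r \<open>s > 0\<close> assms(3) by simp
  ultimately show False
    using assms(1) unfolding slit_plane_def by blast
qed

lemma ball_subset_slit_plane: "ball 0 1 \<subseteq> slit_plane"
  unfolding slit_plane_def by auto

lemma connected_slit_plane: "connected slit_plane"
proof (rule starlike_imp_connected)
  have "closed_segment 0 z \<subseteq> slit_plane" if "z \<in> slit_plane" for z
  proof
    fix w assume "w \<in> closed_segment 0 z"
    then obtain u where "0 \<le> u" "u \<le> 1" "w = z * of_real u"
      by (auto simp: in_segment scaleR_conv_of_real mult.commute)
    then show "w \<in> slit_plane"
      using slit_plane_mult_of_real[OF that] by simp
  qed
  then show "starlike slit_plane"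
    unfolding starlike_def using ball_subset_slit_plane by force
qed

lemma one_minus_slit_plane:
  assumes "z \<in> slit_plane"
  shows "1 - z \<notin> \<real>\<^sub>\<le>\<^sub>0"
proof
  assume "1 - z \<in> \<real>\<^sub>\<le>\<^sub>0"
  then obtain r where r: "1 - z = of_real r" "r \<le> 0"
    by (auto elim: nonpos_Reals_cases)
  then have "z = of_real (1 - r)" "1 - r \<ge> 1"
    by (auto simp: algebra_simps)
  then show False
    using assms unfolding slit_plane_def by blast
qed

text \<open>This resolves the definite description in \<open>hyp2F1\<close>: by the identity theorem
  on the connected open slit plane, all continuations of the series from the unit disc agree at
  z.\<close>

lemma hyp2F1_eqI:
  assumes "f holomorphic_on slit_plane"
    and "\<And>u. norm u < 1 \<Longrightarrow> f u = hyp2F1_series a b c u"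
    and "z \<in> slit_plane"
  shows "hyp2F1 a b c z = f z"
proof (cases "norm z < 1")
  case True
  then show ?thesis
    using assms(2) by (simp add: hyp2F1_def)
next
  case False
  have "(THE w. \<exists>g. g holomorphic_on slit_plane \<and>
           (\<forall>u\<in>ball 0 1. g u = hyp2F1_series a b c u) \<and> g z = w) = f z"
  proof (rule the_equality)
    show "\<exists>g. g holomorphic_on slit_plane \<and>
           (\<forall>u\<in>ball 0 1. g u = hyp2F1_series a b c u) \<and> g z = f z"
      using assms by auto
  next
    fix w
    assume "\<exists>g. g holomorphic_on slit_plane \<and>
           (\<forall>u\<in>ball 0 1. g u = hyp2F1_series a b c u) \<and> g z = w"
    then obtain g where g: "g holomorphic_on slit_plane"
        "\<And>u. u \<in> ball 0 1 \<Longrightarrow> g u = hyp2F1_series a b c u" "g z = w"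
      by blast
    have "g z = f z"
      by (rule analytic_continuation_open[of "ball 0 1" slit_plane])
        (use g assms open_slit_plane connected_slit_plane ball_subset_slit_plane in auto)
    then show "w = f z"
      using g by simp
  qed
  then show ?thesis
    using False by (simp add: hyp2F1_def)
qed

section \<open>The Euler integral\<close>

lemma one_minus_slit_plane_square:
  assumes "z \<in> slit_plane" "t \<in> {-1..1}"
  shows "1 - z * (of_real t)\<^sup>2 \<notin> \<real>\<^sub>\<le>\<^sub>0"
proof -
  have "t\<^sup>2 \<le> 1"
    using assms(2) by (simp add: abs_square_le_1 abs_le_iff)
  then show ?thesis
    using one_minus_slit_plane[OF slit_plane_mult_of_real[OF assms(1), of "t\<^sup>2"]] by simp
qed

lemma continuous_on_powr_const_complex:
  fixes f :: "'a :: t2_space \<Rightarrow> complex"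
  assumes "continuous_on A f" "\<And>z. z \<in> A \<Longrightarrow> f z \<notin> \<real>\<^sub>\<le>\<^sub>0"
  shows "continuous_on A (\<lambda>z. f z powr a)"
  using assms by (intro continuous_on_powr_complex) (force simp: complex_nonpos_Reals_iff)+

lemma continuous_on_euler_integrand:
  assumes "z \<in> slit_plane"
  shows "continuous_on {-1..1} (\<lambda>t::real. (1 - z * (of_real t)\<^sup>2) powr a)"
  using one_minus_slit_plane_square[OF assms]
  by (intro continuous_on_powr_const_complex continuous_intros) auto

lemma holomorphic_on_euler_integral:
  "(\<lambda>z. integral {-1..1} (\<lambda>t::real. (1 - z * (of_real t)\<^sup>2) powr a)) holomorphic_on slit_plane"
proof -
  \<comment> \<open>Differentiation under the integral sign is applied on a convex domain. The slit
    plane is not convex, so the argument runs on balls inside it; holomorphy on an open set is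
    local.\<close>
  have "(\<lambda>z. integral (cbox (-1) 1) (\<lambda>t::real. (1 - z * (of_real t)\<^sup>2) powr a))
          holomorphic_on ball w r"
    if sub: "ball w r \<subseteq> slit_plane" for w r
  proof (rule leibniz_rule_holomorphic)
    fix z :: complex and t :: real
    assume "z \<in> ball w r" "t \<in> cbox (-1) 1"
    then have "1 - z * (of_real t)\<^sup>2 \<notin> \<real>\<^sub>\<le>\<^sub>0"
      using one_minus_slit_plane_square sub by auto
    then show "((\<lambda>z. (1 - z * (of_real t)\<^sup>2) powr a) has_field_derivative
        a * (1 - z * (of_real t)\<^sup>2) powr (a - 1) * (- (of_real t)\<^sup>2)) (at z within ball w r)"
      by (auto intro!: derivative_eq_intros)
  next
    fix z assume "z \<in> ball w r"
    then show "(\<lambda>t::real. (1 - z * (of_real t)\<^sup>2) powr a) integrable_on cbox (-1) 1"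
      using continuous_on_euler_integrand sub by (intro integrable_continuous) auto
  next
    show "continuous_on (ball w r \<times> cbox (-1) 1)
      (\<lambda>(z, t::real). a * (1 - z * (of_real t)\<^sup>2) powr (a - 1) * (- (of_real t)\<^sup>2))"
      unfolding case_prod_unfold
      using one_minus_slit_plane_square sub
      by (intro continuous_intros continuous_on_powr_const_complex) auto
  qed auto
  then show ?thesis
    using open_slit_plane unfolding holomorphic_on_open[OF open_slit_plane]
    by (auto simp: open_contains_ball) (metis centre_in_ball holomorphic_on_open open_ball)
qed

lemma has_integral_even_power:
  "((\<lambda>t::real. (of_real t :: complex) ^ (2 * n)) has_integral 2 / of_nat (2 * n + 1)) {-1..1}"
proof -
  have deriv: "((\<lambda>t. t ^ (2 * n + 1) / real (2 * n + 1)) has_real_derivative t ^ (2 * n)) (at t within A)"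
    for t A
    by (rule DERIV_cong[OF DERIV_cdivide[OF DERIV_pow]]) simp
  have "((\<lambda>t::real. t ^ (2 * n)) has_integral
      1 ^ (2 * n + 1) / real (2 * n + 1) - (-1) ^ (2 * n + 1) / real (2 * n + 1)) {-1..1}"
    by (rule fundamental_theorem_of_calculus)
      (use deriv in \<open>auto simp flip: has_real_derivative_iff_has_vector_derivative\<close>)
  then have "((\<lambda>t::real. of_real (t ^ (2 * n)) :: complex) has_integral
      of_real (2 / real (2 * n + 1))) {-1..1}"
    by (intro has_integral_of_real) (simp add: diff_divide_distrib[symmetric])
  then show ?thesis
    by simp
qed

text \<open>The factors of (3/2)_n are those of (1/2)_n shifted by one, so the quotient telescopes.
  It converts the even moments 2 / (2 n + 1) into the hypergeometric parameters 1/2 and 3/2.\<close>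

lemma pochhammer_half_ratio:
  "pochhammer (1/2) n / pochhammer (3/2) n = (1 / of_nat (2 * n + 1) :: complex)"
proof (induction n)
  case (Suc n)
  have "pochhammer (1/2) (Suc n) / pochhammer (3/2) (Suc n) =
      pochhammer (1/2) n / pochhammer (3/2) n * ((1/2 + of_nat n) / (3/2 + of_nat n) :: complex)"
    by (simp add: pochhammer_Suc)
  also have "(1/2 + of_nat n :: complex) = of_nat (2 * n + 1) / 2"
    by simp
  also have "(3/2 + of_nat n :: complex) = of_nat (2 * Suc n + 1) / 2"
    by simp
  also have "pochhammer (1/2) n / pochhammer (3/2) n *
        (of_nat (2 * n + 1) / 2 / (of_nat (2 * Suc n + 1) / 2)) = (1 / of_nat (2 * Suc n + 1) :: complex)"
  proof -
    have "of_nat (2 * n + 1) \<noteq> (0 :: complex)"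
      by (simp only: of_nat_eq_0_iff)
    then show ?thesis
      unfolding Suc by (simp del: of_nat_add of_nat_mult of_nat_Suc)
  qed
  finally show ?case .
qed simp

lemma integral_euler_eq_hyp2F1_series:
  assumes "norm z < 1"
  shows "integral {-1..1} (\<lambda>t::real. (1 - z * (of_real t)\<^sup>2) powr a) =
           2 * hyp2F1_series (1/2) (- a) (3/2) z"
proof -
  \<comment> \<open>The n-th term of the binomial series of (1 - z t^2)^a, with the powers of z and
    t separated so that only the latter is integrated.\<close>
  define f where "f n t = (a gchoose n) * (- z) ^ n * of_real t ^ (2 * n)" for n and t :: real
  have norm_le: "norm (z * (of_real t)\<^sup>2) \<le> norm z" if "t \<in> {-1..1}" for t :: real
  proof -
    have "t\<^sup>2 \<le> 1"
      using that by (simp add: abs_square_le_1 abs_le_iff)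
    then show ?thesis
      by (simp add: norm_mult norm_power mult_left_le)
  qed
  have f_sums: "(\<lambda>n. f n t) sums (1 - z * (of_real t)\<^sup>2) powr a" if "t \<in> {-1..1}" for t
  proof -
    have "f n t = (a gchoose n) * (- (z * (of_real t)\<^sup>2)) ^ n" for n
      unfolding f_def power_mult mult.assoc power_mult_distrib[symmetric] by simp
    then show ?thesis
      using gen_binomial_complex[of "- (z * (of_real t)\<^sup>2)" a] norm_le[OF that] assms by simp
  qed
  \<comment> \<open>The majorant |(a gchoose n) z^n| is independent of t and summable, since |z| < 1
    lies inside the disc of convergence of the binomial series.\<close>
  have "uniform_limit {-1..1} (\<lambda>n t. \<Sum>i<n. f i t) (\<lambda>t. suminf (\<lambda>i. f i t)) sequentially"
  proof (rule Weierstrass_m_test)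
    fix n and t :: real assume "t \<in> {-1..1}"
    then have "norm t ^ (2 * n) \<le> 1"
      by (intro power_le_one) auto
    then show "norm (f n t) \<le> norm ((a gchoose n) * z ^ n)"
      by (simp add: f_def norm_mult norm_power mult_left_le)
  next
    show "summable (\<lambda>n. norm ((a gchoose n) * z ^ n))"
      by (rule abs_summable_in_conv_radius) (use assms in \<open>simp add: conv_radius_gchoose\<close>)
  qed
  also have "?this \<longleftrightarrow> uniform_limit {-1..1} (\<lambda>n t. \<Sum>i<n. f i t)
      (\<lambda>t. (1 - z * (of_real t)\<^sup>2) powr a) sequentially"
    by (rule uniform_limit_cong') (use f_sums in \<open>auto simp: sums_iff\<close>)
  finally have "uniform_limit {-1..1} (\<lambda>n t. \<Sum>i<n. f i t)
      (\<lambda>t. (1 - z * (of_real t)\<^sup>2) powr a) sequentially" .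
  \<comment> \<open>Uniform convergence of continuous functions on a compact interval allows limit
    and integral to be exchanged.\<close>
  then obtain I J where I: "\<And>n. ((\<lambda>t. \<Sum>i<n. f i t) has_integral I n) {-1..1}"
      and J: "((\<lambda>t::real. (1 - z * (of_real t)\<^sup>2) powr a) has_integral J) {-1..1}"
      and lim: "I \<longlonglongrightarrow> J"
    by (rule uniform_limit_integral) (auto simp: f_def intro!: continuous_intros)
  define c where
    "c n = pochhammer (1/2) n * pochhammer (- a) n / (pochhammer (3/2) n * fact n) * z ^ n" for n
  have "I n = (\<Sum>i<n. 2 * c i)" for n
  proof (rule has_integral_unique[OF I])
    have c_eq: "2 * c i = (a gchoose i) * (- z) ^ i * (2 / of_nat (2 * i + 1))" for i
    proof -
      have "2 * c i = 2 * (pochhammer (1/2) i / pochhammer (3/2) i) * (pochhammer (- a) i / fact i) * z ^ i"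
        by (simp add: c_def)
      also have "\<dots> = (pochhammer (- a) i / fact i) * z ^ i * (2 / of_nat (2 * i + 1))"
        unfolding pochhammer_half_ratio by (simp add: mult_ac)
      also have "(pochhammer (- a) i / fact i) * z ^ i = (a gchoose i) * (- z) ^ i"
      proof -
        \<comment> \<open>One sign (-1)^i comes from (- z)^i, the other from writing the binomial
          coefficient as (-1)^i (-a)_i / i!; they cancel.\<close>
        have "(- z) ^ i = (- 1) ^ i * z ^ i" "(- 1) ^ i * ((- 1) ^ i * y) = y" for y :: complex
          by (simp_all flip: power_mult_distrib mult.assoc)
        then show ?thesis
          by (simp add: gbinomial_pochhammer)
      qed
      finally show ?thesis .
    qed
    show "((\<lambda>t. \<Sum>i<n. f i t) has_integral (\<Sum>i<n. 2 * c i)) {-1..1}"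
      unfolding f_def c_eq
      by (intro has_integral_sum has_integral_mult_right has_integral_even_power) simp
  qed
  then have "I = (\<lambda>n. \<Sum>i<n. 2 * c i)"
    by blast
  then have "(\<lambda>n. 2 * c n) sums J"
    using lim by (simp only: sums_def)
  then have "c sums (J / 2)"
    using sums_divide[of "\<lambda>n. 2 * c n" J 2] by simp
  then have "J = 2 * hyp2F1_series (1/2) (- a) (3/2) z"
    by (auto simp: hyp2F1_series_def c_def[abs_def] sums_iff)
  then show ?thesis
    using J by (simp add: integral_unique)
qed

lemma integral_euler_eq_hyp2F1:
  assumes "z \<in> slit_plane"
  shows "integral {-1..1} (\<lambda>t::real. (1 - z * (of_real t)\<^sup>2) powr a) =
           2 * hyp2F1 (1/2) (- a) (3/2) z"
proof -
  have "hyp2F1 (1/2) (- a) (3/2) z = integral {-1..1} (\<lambda>t::real. (1 - z * (of_real t)\<^sup>2) powr a) / 2"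
    by (rule hyp2F1_eqI)
      (use assms in \<open>auto intro!: holomorphic_intros holomorphic_on_euler_integral
        simp: integral_euler_eq_hyp2F1_series\<close>)
  then show ?thesis
    by (simp only: times_divide_eq_right) simp
qed

section \<open>Reduction to the Euler integral\<close>

lemma has_integral_times_sin_even_cos:
  fixes h :: "real \<Rightarrow> complex"
  assumes cont: "continuous_on {-1..1} h"
    and even: "\<And>t. h (- t) = h t"
  shows "((\<lambda>\<theta>. of_real \<theta> * of_real (sin \<theta>) * h (cos \<theta>)) has_integral
           of_real pi / 2 * integral {-1..1} h) {0..pi}"
proof -
  define F where "F \<theta> = of_real \<theta> * of_real (sin \<theta>) * h (cos \<theta>)" for \<theta>
  have "continuous_on {0..pi} F"
    unfolding F_def
    by (intro continuous_intros continuous_on_compose2[OF cont]) auto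
  then obtain I where I: "(F has_integral I) {0..pi}"
    using integrable_continuous_real by blast
  \<comment> \<open>The reflection maps [0, pi] to itself, so both integrals equal I. In the sum of
    the integrands the weights \<theta> and pi - \<theta> add up to pi, because h is even.\<close>
  have "((\<lambda>\<theta>. F (pi - \<theta>)) has_integral I) {0..pi}"
    using has_integral_affinity[of F I 0 pi "-1" pi] I by simp
  then have "((\<lambda>\<theta>. F \<theta> + F (pi - \<theta>)) has_integral I + I) {0..pi}"
    by (rule has_integral_add[OF I])
  also have "(\<lambda>\<theta>. F \<theta> + F (pi - \<theta>)) = (\<lambda>\<theta>. of_real pi * (sin \<theta> *\<^sub>R h (- cos \<theta>)))"
    by (auto simp: F_def even scaleR_conv_of_real algebra_simps)
  finally have *: "((\<lambda>\<theta>. of_real pi * (sin \<theta> *\<^sub>R h (- cos \<theta>))) has_integral I + I) {0..pi}" .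
  \<comment> \<open>Evenness permits the argument - cos \<theta>, which increases from -1 to 1 with
    derivative sin \<theta>, so the substitution preserves orientation.\<close>
  have "((\<lambda>\<theta>. sin \<theta> *\<^sub>R h (- cos \<theta>)) has_integral integral {- cos 0..- cos pi} h) {0..pi}"
    by (rule has_integral_substitution[where c = "-1" and d = 1])
      (use cont in \<open>auto intro!: derivative_eq_intros\<close>)
  then have "((\<lambda>\<theta>. of_real pi * (sin \<theta> *\<^sub>R h (- cos \<theta>))) has_integral of_real pi * integral {-1..1} h) {0..pi}"
    by (intro has_integral_mult_right) simp
  with * have "I + I = of_real pi * integral {-1..1} h"
    by (rule has_integral_unique)
  then have "I = of_real pi / 2 * integral {-1..1} h"
    by (simp add: field_simps)
  then show ?thesis
    using I unfolding F_def by (simp only:)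
qed

theorem mainTheorem6:
  fixes k x :: complex
  assumes "k \<noteq> 0"
    and "- x\<^sup>2 \<in> slit_plane"
  shows "((\<lambda>\<theta>::real. of_real \<theta> * of_real (sin \<theta>) * (1 + x\<^sup>2 * (of_real (cos \<theta>))\<^sup>2) powr (1 / k))
           has_integral (of_real pi * hyp2F1 (1/2) (- (1 / k)) (3/2) (- x\<^sup>2))) {0..pi}"
  \<comment> \<open>Here h t = (1 - z t^2) powr (1 / k) with z = - x^2; the factor pi / 2 meets the
    2 from the Euler integral.\<close>
  using has_integral_times_sin_even_cos[OF continuous_on_euler_integrand[OF assms(2), of "1 / k"]]
  by (simp add: integral_euler_eq_hyp2F1[OF assms(2), of "1 / k", simplified])

end
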